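(* Let $V$ be a finite set of $n\ge 1$ voters, $C$ a finite set of candidates, and $k\ge 1$ an integer with $k\le |C|$. Let $((A_i^+,A_i^-))_{i\in V}$ be a trichotomous preference profile over $C$ that is decisive, i.e. $A_i^0=\emptyset$ for every $i\in V$, and let $(A_i)_{i\in V}$ with $A_i=A_i^+$ be the corresponding dichotomous (approval) profile. Then a committee $W\subseteq C$ with $|W|=k$ satisfies Proportional Justified Representation with respect to the dichotomous profile $(A_i)_{i\in V}$ if and only if it satisfies Weak Trichotomous Proportional Justified Representation with respect to the trichotomous profile $((A_i^+,A_i^-))_{i\in V}$.
   Context: A trichotomous preference profile assigns to each voter $i\in V$ an approval set $A_i^+\subseteq C$ and a disapproval set $A_i^-\subseteq C$ with $A_i^+\cap A_i^-=\emptyset$; the indifference set is $A_i^0=C\setminus(A_i^+\cup A_i^-)$. A dichotomous (approval) profile assigns to each voter $i$ an approval set $A_i\subseteq C$. A trichotomous profile with all $A_i^0$ empty is identified with the dichotomous profile with $A_i=A_i^+$ and $C\setminus A_i=A_i^-$. A committee is a subset $W\subseteq C$ of size exactly $k$. Write $[k]=\{1,\dots,k\}$. Proportional Justified Representation (PJR): a committee $W$ satisfies PJR with respect to $(A_i)_{i\in V}$ if there do not exist $l\in[k]$ and a group of voters $V'\subseteq V$ with $|V'|\ge l\frac{n}{k}$ such that $|\bigcap_{i\in V'}A_i|\ge l$ but $|(\bigcup_{i\in V'}A_i)\cap W|<l$. Weak Trichotomous Proportional Justified Representation (WTPJR): a committee $W$ satisfies WTPJR with respect to $((A_i^+,A_i^-))_{i\in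 V}$ if for every $l\in[k]$ and every $V'\subseteq V$ with $|V'|\ge l\frac{n}{k}$ and $|(\bigcup_{i\in V'}A_i^+)\setminus(\bigcup_{i\in V'}A_i^-)|\ge l$, one has $|(\bigcup_{i\in V'}A_i^+)\cap W|\ge l$. *)

theory Defs
  imports Complex_Main
begin

text \<open>
  A trichotomous profile is given by its approval sets \<open>Ap i\<close> and disapproval sets \<open>Am i\<close>;
  only the values at voters \<open>i \<in> V\<close> are relevant.
\<close>

definition trichotomous_profile ::
    "'v set \<Rightarrow> 'c set \<Rightarrow> ('v \<Rightarrow> 'c set) \<Rightarrow> ('v \<Rightarrow> 'c set) \<Rightarrow> bool" where
  "trichotomous_profile V C Ap Am \<longleftrightarrow>
     (\<forall>i\<in>V. Ap i \<subseteq> C \<and> Am i \<subseteq> C \<and> Ap i \<inter> Am i = {})"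

definition indifference_set ::
    "'c set \<Rightarrow> ('v \<Rightarrow> 'c set) \<Rightarrow> ('v \<Rightarrow> 'c set) \<Rightarrow> 'v \<Rightarrow> 'c set" where
  "indifference_set C Ap Am i = C - (Ap i \<union> Am i)"

definition decisive ::
    "'v set \<Rightarrow> 'c set \<Rightarrow> ('v \<Rightarrow> 'c set) \<Rightarrow> ('v \<Rightarrow> 'c set) \<Rightarrow> bool" where
  "decisive V C Ap Am \<longleftrightarrow> (\<forall>i\<in>V. indifference_set C Ap Am i = {})"

definition committee :: "'c set \<Rightarrow> nat \<Rightarrow> 'c set \<Rightarrow> bool" where
  "committee C k W \<longleftrightarrow> W \<subseteq> C \<and> card W = k"

text \<open>
  The empty intersection is \<open>UNIV\<close>, but for \<open>l \<ge> 1\<close>, \<open>k \<ge> 1\<close> and nonempty finite \<open>V\<close>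
  the size condition on \<open>V'\<close> forces \<open>V'\<close> to be nonempty.
\<close>

definition PJR :: "'v set \<Rightarrow> nat \<Rightarrow> ('v \<Rightarrow> 'c set) \<Rightarrow> 'c set \<Rightarrow> bool" where
  "PJR V k A W \<longleftrightarrow>
     \<not> (\<exists>l\<in>{1..k}. \<exists>V'\<subseteq>V.
          real (card V') \<ge> real l * (real (card V) / real k) \<and>
          card (\<Inter>i\<in>V'. A i) \<ge> l \<and>
          card ((\<Union>i\<in>V'. A i) \<inter> W) < l)"

definition WTPJR ::
    "'v set \<Rightarrow> nat \<Rightarrow> ('v \<Rightarrow> 'c set) \<Rightarrow> ('v \<Rightarrow> 'c set) \<Rightarrow> 'c set \<Rightarrow> bool" where
  "WTPJR V k Ap Am W \<longleftrightarrow>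
     (\<forall>l\<in>{1..k}. \<forall>V'\<subseteq>V.
        real (card V') \<ge> real l * (real (card V) / real k) \<and>
        card ((\<Union>i\<in>V'. Ap i) - (\<Union>i\<in>V'. Am i)) \<ge> l \<longrightarrow>
        card ((\<Union>i\<in>V'. Ap i) \<inter> W) \<ge> l)"

end

theory Submission
  imports Defs
begin

text \<open>Decisiveness makes each \<open>Ap i\<close> the complement of \<open>Am i\<close> in
  \<open>C\<close>. By De Morgan, the candidates approved by every member of a nonempty group are
  then exactly those approved by some member and disapproved by none
  (\<open>decisive_INT_eq\<close>). So PJR and WTPJR impose the same cohesion condition and the same
  conclusion on every group that meets the size bound, and such groups are never empty.\<close>

lemma decisive_INT_eq:
  assumes "trichotomous_profile V C Ap Am" and "decisive V C Ap Am"
    and "S \<subseteq> V" and "S \<noteq> {}"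
  shows "(\<Inter>i\<in>S. Ap i) = (\<Union>i\<in>S. Ap i) - (\<Union>i\<in>S. Am i)"
proof -
  have compl: "Ap i = C - Am i" if "i \<in> S" for i
  proof -
    have "i \<in> V"
      using assms(3) that by blast
    then have "Ap i \<subseteq> C" "Ap i \<inter> Am i = {}" "C - (Ap i \<union> Am i) = {}"
      using assms(1,2) by (simp_all add: trichotomous_profile_def decisive_def indifference_set_def)
    then show ?thesis
      by blast
  qed
  have "(\<Inter>i\<in>S. Ap i) = (\<Inter>i\<in>S. C - Am i)"
    using compl by simp
  \<comment> \<open>A member of \<open>S\<close> is needed here: for empty \<open>S\<close> the left
    side is \<open>UNIV\<close> and the right side is empty.\<close>
  also have "\<dots> = (\<Union>i\<in>S. C - Am i) - (\<Union>i\<in>S. Am i)"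
    using assms(4) by auto
  also have "\<dots> = (\<Union>i\<in>S. Ap i) - (\<Union>i\<in>S. Am i)"
    using compl by simp
  finally show ?thesis .
qed

theorem proposition1:
  fixes V :: "'v set" and C :: "'c set" and k :: nat
    and Ap Am A :: "'v \<Rightarrow> 'c set" and W :: "'c set"
  assumes "finite V" and "card V \<ge> 1"
    and "finite C"
    and "k \<ge> 1" and "k \<le> card C"
    and "trichotomous_profile V C Ap Am"
    and "decisive V C Ap Am"
    and "\<And>i. i \<in> V \<Longrightarrow> A i = Ap i"
    and "committee C k W"
  shows "PJR V k A W \<longleftrightarrow> WTPJR V k Ap Am W"
proof -
  have eqs: "(\<Inter>i\<in>S. A i) = (\<Union>i\<in>S. Ap i) - (\<Union>i\<in>S. Am i)"
      "(\<Union>i\<in>S. A i) = (\<Union>i\<in>S. Ap i)"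
    if "l \<in> {1..k}" "S \<subseteq> V" "real (card S) \<ge> real l * (real (card V) / real k)" for l S
  proof -
    \<comment> \<open>As \<open>l\<close>, \<open>card V\<close> and \<open>k\<close> are all at
      least 1, the quota is positive, which the empty group with cardinality 0 cannot reach.\<close>
    have "real l * (real (card V) / real k) > 0"
      using that(1) assms(2,4) by simp
    with that(3) have "S \<noteq> {}"
      by auto
    have A: "A i = Ap i" if "i \<in> S" for i
      using that \<open>S \<subseteq> V\<close> assms(8) by blast
    show "(\<Union>i\<in>S. A i) = (\<Union>i\<in>S. Ap i)"
      using A by simp
    show "(\<Inter>i\<in>S. A i) = (\<Union>i\<in>S. Ap i) - (\<Union>i\<in>S. Am i)"
      using A decisive_INT_eq[OF assms(6,7) \<open>S \<subseteq> V\<close> \<open>S \<noteq> {}\<close>] by simp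
  qed
  have pjr: "PJR V k A W \<longleftrightarrow> (\<forall>l\<in>{1..k}. \<forall>S\<subseteq>V.
      real (card S) \<ge> real l * (real (card V) / real k) \<and> card (\<Inter>i\<in>S. A i) \<ge> l \<longrightarrow>
      card ((\<Union>i\<in>S. A i) \<inter> W) \<ge> l)"
    \<comment> \<open>Reading \<open><\<close> as a negated \<open>\<le>\<close> turns the absence
      of a violating group into a universal implication of the shape of
      \<open>WTPJR\<close>.\<close>
    unfolding PJR_def not_le[symmetric] by blast
  have "(real (card S) \<ge> real l * (real (card V) / real k) \<and> card (\<Inter>i\<in>S. A i) \<ge> l \<longrightarrow>
      card ((\<Union>i\<in>S. A i) \<inter> W) \<ge> l) \<longleftrightarrow>
    (real (card S) \<ge> real l * (real (card V) / real k) \<and>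
      card ((\<Union>i\<in>S. Ap i) - (\<Union>i\<in>S. Am i)) \<ge> l \<longrightarrow>
      card ((\<Union>i\<in>S. Ap i) \<inter> W) \<ge> l)"
    if "l \<in> {1..k}" "S \<subseteq> V" for l S
  \<comment> \<open>\<open>eqs\<close> covers only groups that meet the quota; below it both
    implications hold vacuously.\<close>
  proof (cases "real (card S) \<ge> real l * (real (card V) / real k)")
    case True
    show ?thesis
      unfolding eqs[OF that True] ..
  next
    case False
    then show ?thesis
      by blast
  qed
  then show ?thesis
    unfolding pjr WTPJR_def by blast
qed

end
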